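(* Let $d\ge 1$ be an integer, let $C_d=\frac{1}{d+1}\binom{2d}{d}$ be the $d$-th Catalan number, and let $p_{2d,d}$ be the number of $d$-minimal permutations of length $2d$. Then $$C_d=p_{2d,d}=(2d)!\cdot\det(M_d),$$ where $M_d=(m_{i,j})_{1\le i,j\le d}$ is the $d\times d$ matrix with $m_{i,j}=\frac{1}{(j-i+2)!}$ if $i\le j$, $m_{i,i-1}=1$, $m_{i,i-2}=1$, and $m_{i,j}=0$ if $i>j+2$.
   Context: A descent of a permutation $\sigma=\sigma(1)\cdots\sigma(n)$ of $\{1,\dots,n\}$ is an index $i\in\{1,\dots,n-1\}$ with $\sigma(i)>\sigma(i+1)$. A permutation $\sigma$ of length $n$ is $d$-minimal (a minimal permutation with $d$ descents) if it is minimal, for the pattern-involvement order, for the property of having $d$ descents; in other words, $\sigma$ has exactly $d$ descents and, whenever any one of its entries is removed and the remaining entries are renamed order-isomorphically to $1,\dots,n-1$, the resulting permutation has $d-1$ descents. *)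

theory Defs
  imports
    Complex_Main
    "HOL-Library.Sublist"
    "HOL-Combinatorics.Multiset_Permutations"
    "Jordan_Normal_Form.Determinant"
begin

text \<open>
  A permutation of \<open>{1..n}\<close> is its one-line word \<open>\<sigma>(1) ... \<sigma>(n)\<close>, an element of
  \<open>permutations_of_set {1..n}\<close>. List positions count from 0, so the descent set
  is shifted by one with respect to the usual convention.
\<close>

definition descents :: "nat list \<Rightarrow> nat set" where
  "descents \<sigma> = {i. Suc i < length \<sigma> \<and> \<sigma> ! i > \<sigma> ! Suc i}"

definition num_descents :: "nat list \<Rightarrow> nat" where
  "num_descents \<sigma> = card (descents \<sigma>)"

text \<open>Order-isomorphic renaming of a word with distinct letters to a permutation of \<open>{1..k}\<close>.\<close>

definition standardize :: "nat list \<Rightarrow> nat list" where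
  "standardize xs = map (\<lambda>x. card {y \<in> set xs. y \<le> x}) xs"

definition pattern_of :: "nat list \<Rightarrow> nat list \<Rightarrow> bool" where
  "pattern_of \<pi> \<sigma> \<longleftrightarrow> (\<exists>xs. subseq xs \<sigma> \<and> \<pi> = standardize xs)"

definition minimal_perm :: "nat \<Rightarrow> nat \<Rightarrow> nat list \<Rightarrow> bool" where
  "minimal_perm n d \<sigma> \<longleftrightarrow>
     \<sigma> \<in> permutations_of_set {1..n} \<and> num_descents \<sigma> = d \<and>
     (\<forall>\<pi>. pattern_of \<pi> \<sigma> \<and> \<pi> \<noteq> \<sigma> \<longrightarrow> num_descents \<pi> \<noteq> d)"

definition num_minimal_perms :: "nat \<Rightarrow> nat \<Rightarrow> nat" where
  "num_minimal_perms n d = card {\<sigma>. minimal_perm n d \<sigma>}"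

definition catalan :: "nat \<Rightarrow> real" where
  "catalan d = 1 / (real d + 1) * real ((2 * d) choose d)"

text \<open>The indices of \<open>m_entry\<close> start at 1, those of \<^const>\<open>mat\<close> at 0.\<close>

definition m_entry :: "nat \<Rightarrow> nat \<Rightarrow> real" where
  "m_entry i j =
     (if i \<le> j then 1 / fact (j - i + 2)
      else if i = j + 1 then 1
      else if i = j + 2 then 1
      else 0)"

definition M_mat :: "nat \<Rightarrow> real mat" where
  "M_mat d = mat d d (\<lambda>(i, j). m_entry (i + 1) (j + 1))"

text \<open>
  Minimality for pattern involvement agrees with the description by removal of
  single entries (\<open>minimal_perm_iff_remove\<close> below).
\<close>

definition remove_entry :: "nat \<Rightarrow> nat list \<Rightarrow> nat list" where
  "remove_entry i \<sigma> = standardize (take i \<sigma> @ drop (Suc i) \<sigma>)"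

lemma standardize_less_iff:
  assumes "i < length xs" "j < length xs"
  shows "standardize xs ! i < standardize xs ! j \<longleftrightarrow> xs ! i < xs ! j"
proof -
  have mono: "card {y \<in> set xs. y \<le> a} \<le> card {y \<in> set xs. y \<le> b}" if "a \<le> b" for a b
    using that by (intro card_mono) auto
  have "card {y \<in> set xs. y \<le> a} < card {y \<in> set xs. y \<le> b}" if "a < b" "b \<in> set xs" for a b
  proof (intro psubset_card_mono psubsetI)
    have "b \<in> {y \<in> set xs. y \<le> b}" "b \<notin> {y \<in> set xs. y \<le> a}"
      using that by auto
    then show "{y \<in> set xs. y \<le> a} \<noteq> {y \<in> set xs. y \<le> b}" by blast
  qed (use that in auto)
  with mono show ?thesis
    using assms by (force simp: standardize_def not_less[symmetric])
qed

lemma length_standardize [simp]: "length (standardize xs) = length xs"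
  by (simp add: standardize_def)

lemma num_descents_standardize [simp]: "num_descents (standardize xs) = num_descents xs"
proof -
  have "descents (standardize xs) = descents xs"
    by (auto simp: descents_def standardize_less_iff)
  then show ?thesis by (simp add: num_descents_def)
qed

lemma standardize_permutation:
  assumes "\<sigma> \<in> permutations_of_set {1..n}"
  shows "standardize \<sigma> = \<sigma>"
proof -
  have s: "set \<sigma> = {1..n}" using assms by (simp add: permutations_of_set_def)
  have "card {y \<in> set \<sigma>. y \<le> x} = x" if "x \<in> set \<sigma>" for x
  proof -
    have "{y \<in> set \<sigma>. y \<le> x} = {1..x}" using that unfolding s by auto
    then show ?thesis by simp
  qed
  then show ?thesis by (simp add: standardize_def map_idI)
qed

lemma finite_descents: "finite (descents xs)"
  by (rule finite_subset[of _ "{..<length xs}"]) (auto simp: descents_def)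

lemma num_descents_Nil: "num_descents [] = 0"
  by (simp add: num_descents_def descents_def)

lemma num_descents_single: "num_descents [x] = 0"
  by (simp add: num_descents_def descents_def)

lemma num_descents_Cons:
  "num_descents (x # y # zs) = (if x > y then 1 else 0) + num_descents (y # zs)"
proof -
  have "descents (x # y # zs) = (if x > y then {0} else {}) \<union> Suc ` descents (y # zs)"
    (is "?l = ?r")
  proof (rule Set.set_eqI)
    fix i show "i \<in> ?l \<longleftrightarrow> i \<in> ?r"
      by (cases i) (auto simp: descents_def)
  qed
  then show ?thesis
    using finite_descents[of "y # zs"]
    by (auto simp: num_descents_def card_image card_insert_if)
qed

lemma num_descents_remove:
  "num_descents (ys @ zs) \<le> num_descents (ys @ x # zs) \<and>
   num_descents (ys @ x # zs) \<le> Suc (num_descents (ys @ zs))"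
proof (induction ys)
  case Nil
  show ?case
    by (cases zs) (auto simp: num_descents_Cons num_descents_Nil num_descents_single)
next
  case (Cons a ys)
  show ?case
  proof (cases ys)
    case Nil
    then show ?thesis
      by (cases zs) (auto simp: num_descents_Cons num_descents_Nil num_descents_single)
  next
    case (Cons b bs)
    then show ?thesis using Cons.IH by (auto simp: num_descents_Cons)
  qed
qed

lemma num_descents_subseq: "subseq xs ys \<Longrightarrow> num_descents xs \<le> num_descents ys"
proof -
  have "subseq xs ys \<Longrightarrow> num_descents (us @ xs) \<le> num_descents (us @ ys)" for us
  proof (induction xs ys arbitrary: us rule: list_emb.induct)
    case (list_emb_Nil ys)
    show ?case
    proof (induction ys)
      case (Cons y ys)
      then show ?case
        using num_descents_remove[of us ys y] by simp
    qed simp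
  next
    case (list_emb_Cons xs ys y)
    then show ?case
      using num_descents_remove[of us ys y] order_trans by blast
  next
    case (list_emb_Cons2 x y xs ys)
    then show ?case using list_emb_Cons2.IH[of "us @ [x]"] by simp
  qed
  from this[of "[]"] show "subseq xs ys \<Longrightarrow> num_descents xs \<le> num_descents ys" by simp
qed

lemma subseq_neq_remove:
  assumes "subseq xs ys" "xs \<noteq> ys"
  obtains i where "i < length ys" "subseq xs (take i ys @ drop (Suc i) ys)"
proof -
  have "\<exists>i<length ys. subseq xs (take i ys @ drop (Suc i) ys)"
    using assms
  proof (induction xs ys rule: list_emb.induct)
    case (list_emb_Nil ys)
    then show ?case by auto
  next
    case (list_emb_Cons xs ys y)
    then show ?case by (intro exI[of _ 0]) simp
  next
    case (list_emb_Cons2 x y xs ys)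
    then obtain i where "i < length ys" "subseq xs (take i ys @ drop (Suc i) ys)"
      by auto
    then show ?case using list_emb_Cons2 by (intro exI[of _ "Suc i"]) simp
  qed
  then show ?thesis using that by blast
qed

lemma minimal_perm_iff_remove:
  assumes "d \<ge> 1"
  shows "minimal_perm n d \<sigma> \<longleftrightarrow>
     \<sigma> \<in> permutations_of_set {1..n} \<and> num_descents \<sigma> = d \<and>
     (\<forall>i<n. num_descents (remove_entry i \<sigma>) = d - 1)"
proof (cases "\<sigma> \<in> permutations_of_set {1..n}")
  case True
  then have len: "length \<sigma> = n" by (auto simp: length_finite_permutations_of_set)
  have split: "\<sigma> = take i \<sigma> @ \<sigma> ! i # drop (Suc i) \<sigma>" if "i < n" for i
    using that len by (simp add: id_take_nth_drop)
  show ?thesis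
  proof (intro iffI conjI allI impI)
    assume m: "minimal_perm n d \<sigma>"
    then show "\<sigma> \<in> permutations_of_set {1..n}" and d: "num_descents \<sigma> = d"
      by (auto simp: minimal_perm_def)
    fix i assume i: "i < n"
    let ?t = "take i \<sigma> @ drop (Suc i) \<sigma>"
    have "subseq ?t \<sigma>"
      by (subst (3) split[OF i]) (intro list_emb_append_mono subseq_order.refl list_emb_Cons)
    then have "pattern_of (remove_entry i \<sigma>) \<sigma>"
      by (auto simp: pattern_of_def remove_entry_def)
    moreover have "length (remove_entry i \<sigma>) \<noteq> length \<sigma>"
      using i len by (simp add: remove_entry_def)
    ultimately have "num_descents (remove_entry i \<sigma>) \<noteq> d"
      using m by (auto simp: minimal_perm_def)
    then show "num_descents (remove_entry i \<sigma>) = d - 1"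
      using num_descents_remove[of "take i \<sigma>" "drop (Suc i) \<sigma>" "\<sigma> ! i"] d
      unfolding split[OF i, symmetric] remove_entry_def by auto
  next
    assume r: "\<sigma> \<in> permutations_of_set {1..n} \<and> num_descents \<sigma> = d \<and>
      (\<forall>i<n. num_descents (remove_entry i \<sigma>) = d - 1)"
    have "num_descents \<pi> \<noteq> d" if p: "pattern_of \<pi> \<sigma>" "\<pi> \<noteq> \<sigma>" for \<pi>
    proof -
      obtain xs where xs: "subseq xs \<sigma>" "\<pi> = standardize xs"
        using p by (auto simp: pattern_of_def)
      then have "xs \<noteq> \<sigma>" using p standardize_permutation[OF True] by auto
      then obtain i where i: "i < length \<sigma>" "subseq xs (take i \<sigma> @ drop (Suc i) \<sigma>)"
        using xs subseq_neq_remove by blast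
      then have "num_descents xs \<le> d - 1"
        using num_descents_subseq[OF i(2)] r len by (simp add: remove_entry_def)
      then show ?thesis using xs assms by simp
    qed
    then show "minimal_perm n d \<sigma>" using r by (auto simp: minimal_perm_def)
  qed
qed (auto simp: minimal_perm_def)

end

theory Submission
  imports Defs
begin

text \<open>
  Removing an entry \<open>\<sigma>(p)\<close> changes the descents only around \<open>p\<close>. So every removal
  destroys exactly one descent iff \<open>\<sigma>\<close> begins and ends with a descent, has no two
  consecutive ascents, and satisfies \<open>\<sigma>(p-1) < \<sigma>(p+1)\<close> at each interior peak or valley
  \<open>p\<close>. If \<open>\<sigma>\<close> has length \<open>2d\<close> and \<open>d\<close> descents, there are \<open>d - 1\<close> ascents, which is as
  many as these conditions permit, so descents and ascents alternate and every
  interior position is a peak or a valley. Hence \<open>\<sigma> = a\<^sub>1 b\<^sub>1 a\<^sub>2 b\<^sub>2 ... a\<^sub>d b\<^sub>d\<close> is minimal iff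
  the \<open>a\<^sub>i\<close> increase, the \<open>b\<^sub>i\<close> increase and \<open>b\<^sub>i < a\<^sub>i\<close> for all \<open>i\<close>: a standard Young
  tableau with \<open>d\<close> rows and two columns (\<open>minimal_perm_imp_two_column\<close> and
  \<open>two_column_imp_minimal_perm\<close>).

  Such a tableau is determined by the set of the \<open>a\<^sub>i\<close>, and the sets that occur are
  the solutions of the ballot problem (\<open>bij_betw_two_column_ballot\<close>): among \<open>1, ..., j\<close>
  at most half of the numbers are chosen, for each \<open>j\<close>. Deleting the largest number
  gives a Pascal recurrence, which is solved by differences of adjacent binomial
  coefficients (\<open>card_ballot\<close>) and yields the Catalan number.

  By Aitken's formula the determinant is the number of these tableaux divided by
  \<open>(2d)!\<close>; here it is evaluated directly. All entries of \<open>M\<^sub>d\<close> have the form \<open>1 / (j - i + 2)!\<close>, where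
  the reciprocal factorial of a negative number is 0; up to row and column
  scaling they are binomial coefficients \<open>(i + 2 choose j)\<close> of the transposed indices.
  Vandermonde's convolution is an LU decomposition of this binomial matrix, so the
  determinant is a product of diagonal entries.
\<close>

section \<open>The determinant\<close>

text \<open>
  Writing a reciprocal factorial as a binomial coefficient absorbs all four cases of
  the matrix entry, the zeros included, since \<open>(i + 2 choose j) = 0\<close> for \<open>j > i + 2\<close>.
\<close>

lemma m_entry_eq_binomial:
  "m_entry (j + 1) (i + 1) = real ((i + 2) choose j) * fact j / fact (i + 2)"
proof (cases "j \<le> i + 2")
  case True
  then have "real ((i + 2) choose j) = fact (i + 2) / (fact j * fact (i + 2 - j))"
    by (rule binomial_fact)
  then have "real ((i + 2) choose j) * fact j / fact (i + 2) = 1 / fact (i + 2 - j)"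
    by (simp del: fact_Suc)
  moreover have "m_entry (j + 1) (i + 1) = 1 / fact (i + 2 - j)"
  proof -
    consider "j \<le> i" | "j = i + 1" | "j = i + 2" using True by linarith
    then show ?thesis by cases (auto simp: m_entry_def Suc_diff_le)
  qed
  ultimately show ?thesis by simp
qed (auto simp: m_entry_def binomial_eq_0)

text \<open>
  An entry of the product is Vandermonde's convolution
  \<open>(\<Sum>k. (i choose k) * (2 choose (j - k))) = (i + 2 choose j)\<close>, with the row scaling moved into
  the lower and the column scaling into the upper triangular factor.
\<close>

lemma transpose_M_mat_factorization:
  "transpose_mat (M_mat d) =
     mat d d (\<lambda>(i, k). real (i choose k) / fact (i + 2)) *
     mat d d (\<lambda>(k, j). if k \<le> j then real (2 choose (j - k)) * fact j else 0)"
  (is "_ = ?L * ?U")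
proof (rule eq_matI)
  fix i j assume "i < dim_row (?L * ?U)" "j < dim_col (?L * ?U)"
  then have i: "i < d" and j: "j < d" by auto
  have "(?L * ?U) $$ (i, j) =
      (\<Sum>k<d. real (i choose k) / fact (i + 2) *
        (if k \<le> j then real (2 choose (j - k)) * fact j else 0))"
    using i j by (simp add: scalar_prod_def atLeast0LessThan)
  also have "\<dots> = (\<Sum>k\<le>j. real (i choose k) / fact (i + 2) *
        (real (2 choose (j - k)) * fact j))"
    using j by (intro sum.mono_neutral_cong_right) auto
  also have "\<dots> = real (\<Sum>k\<le>j. (i choose k) * (2 choose (j - k))) * fact j / fact (i + 2)"
    by (simp add: sum_distrib_left sum_distrib_right sum_divide_distrib mult_ac del: fact_Suc)
  also have "\<dots> = m_entry (j + 1) (i + 1)"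
    by (simp only: vandermonde m_entry_eq_binomial)
  finally show "transpose_mat (M_mat d) $$ (i, j) = (?L * ?U) $$ (i, j)"
    using i j by (simp add: M_mat_def)
qed (auto simp: M_mat_def)

lemma det_M_mat: "det (M_mat d) = 1 / (fact d * fact (d + 1))"
proof -
  define L where "L = mat d d (\<lambda>(i, k). real (i choose k) / fact (i + 2))"
  define U where "U = mat d d (\<lambda>(k, j). if k \<le> j then real (2 choose (j - k)) * fact j else 0)"
  have L: "L \<in> carrier_mat d d" and U: "U \<in> carrier_mat d d"
    by (auto simp: L_def U_def)
  have "det (M_mat d) = det (transpose_mat (M_mat d))"
    by (rule det_transpose[symmetric, where n = d]) (simp add: M_mat_def)
  also have "\<dots> = det (L * U)"
    unfolding transpose_M_mat_factorization L_def U_def ..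
  also have "\<dots> = det L * det U"
    by (rule det_mult[OF L U])
  also have "det L = prod_list (diag_mat L)"
    by (rule det_lower_triangular[OF _ L]) (auto simp: L_def)
  also have "\<dots> = (\<Prod>i<d. 1 / fact (i + 2))"
    unfolding diag_mat_def
    by (subst prod.list_conv_set_nth) (simp add: L_def atLeast0LessThan)
  also have "det U = prod_list (diag_mat U)"
    by (rule det_upper_triangular[OF _ U]) (auto simp: U_def)
  also have "\<dots> = (\<Prod>i<d. fact i)"
    unfolding diag_mat_def
    by (subst prod.list_conv_set_nth) (simp add: U_def atLeast0LessThan)
  also have "(\<Prod>i<d. 1 / fact (i + 2)) * (\<Prod>i<d. fact i) = (1 / (fact d * fact (d + 1)) :: real)"
  proof (induction d)
    case (Suc d)
    have "(\<Prod>i<Suc d. 1 / fact (i + 2)) * (\<Prod>i<Suc d. fact i) =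
        ((\<Prod>i<d. 1 / fact (i + 2)) * (\<Prod>i<d. fact i)) * (fact d / fact (d + 2) :: real)"
      by (simp add: mult_ac del: fact_Suc)
    also have "\<dots> = 1 / (fact (Suc d) * fact (Suc d + 1))"
      unfolding Suc.IH by (simp del: fact_Suc)
    finally show ?case .
  qed simp
  finally show ?thesis .
qed

section \<open>Ballot sets\<close>

text \<open>
  Read the numbers \<open>1, ..., n\<close> as successive votes, with \<open>A\<close> the set of the votes for the
  second candidate, who is never ahead of the first.
\<close>

definition ballot :: "nat \<Rightarrow> nat \<Rightarrow> nat set set" where
  "ballot n k =
     {A. A \<subseteq> {1..n} \<and> card A = k \<and> (\<forall>j\<le>n. 2 * card (A \<inter> {1..j}) \<le> j)}"

lemma finite_ballot: "finite (ballot n k)"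
  by (rule finite_subset[of _ "Pow {1..n}"]) (auto simp: ballot_def)

lemma ballot_0: "ballot n 0 = {{}}"
  by (auto simp: ballot_def dest: finite_subset)

lemma ballot_empty: "n < 2 * k \<Longrightarrow> ballot n k = {}"
proof -
  assume "n < 2 * k"
  have "2 * k \<le> n" if "A \<in> ballot n k" for A
  proof -
    have "A \<inter> {1..n} = A" using that by (auto simp: ballot_def)
    then show ?thesis using that by (auto simp: ballot_def)
  qed
  with \<open>n < 2 * k\<close> show ?thesis by fastforce
qed

text \<open>
  The ballot condition at \<open>j = Suc n\<close> is the hypothesis, and the conditions at \<open>j \<le> n\<close> do
  not depend on whether \<open>Suc n\<close> is chosen.
\<close>

lemma ballot_Suc:
  assumes "2 * Suc k \<le> Suc n"
  shows "ballot (Suc n) (Suc k) = ballot n (Suc k) \<union> insert (Suc n) ` ballot n k"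
proof (intro Set.set_eqI iffI)
  fix A assume A: "A \<in> ballot (Suc n) (Suc k)"
  then have fin: "finite A" by (auto simp: ballot_def intro: finite_subset)
  show "A \<in> ballot n (Suc k) \<union> insert (Suc n) ` ballot n k"
  proof (cases "Suc n \<in> A")
    case True
    have "(A - {Suc n}) \<inter> {1..j} = A \<inter> {1..j}" if "j \<le> n" for j
      using that by auto
    then have "A - {Suc n} \<in> ballot n k"
      using A True fin by (auto simp: ballot_def le_Suc_eq)
    then show ?thesis using True by (metis UnI2 image_eqI insert_Diff)
  next
    case False
    have "A \<subseteq> {1..Suc n} - {Suc n}" using A False by (auto simp: ballot_def)
    also have "\<dots> = {1..n}" by auto
    finally have "A \<in> ballot n (Suc k)" using A by (auto simp: ballot_def)
    then show ?thesis by simp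
  qed
next
  fix A assume "A \<in> ballot n (Suc k) \<union> insert (Suc n) ` ballot n k"
  then show "A \<in> ballot (Suc n) (Suc k)"
  proof
    assume A: "A \<in> ballot n (Suc k)"
    then have "A \<inter> {1..Suc n} = A" by (auto simp: ballot_def)
    with A assms show ?thesis by (auto simp: ballot_def le_Suc_eq)
  next
    assume "A \<in> insert (Suc n) ` ballot n k"
    then obtain B where B: "B \<in> ballot n k" and AB: "A = insert (Suc n) B" by auto
    have fin: "finite B" and "Suc n \<notin> B" and sub: "B \<subseteq> {1..n}"
      using B by (auto simp: ballot_def intro: finite_subset)
    then have card: "card A = Suc k" using B AB by (simp add: ballot_def)
    have "A \<inter> {1..Suc n} = A" using AB sub by auto
    moreover have "A \<inter> {1..j} = B \<inter> {1..j}" if "j \<le> n" for j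
      using that AB by auto
    ultimately show ?thesis
      using B AB card assms sub by (auto simp: ballot_def le_Suc_eq)
  qed
qed

lemma card_ballot_Suc:
  assumes "2 * Suc k \<le> Suc n"
  shows "card (ballot (Suc n) (Suc k)) = card (ballot n (Suc k)) + card (ballot n k)"
proof -
  have notin: "Suc n \<notin> A" if "A \<in> ballot n l" for A l
    using that by (auto simp: ballot_def)
  have "inj_on (insert (Suc n)) (ballot n k)"
    by (intro inj_onI) (metis insert_ident notin)
  moreover have "ballot n (Suc k) \<inter> insert (Suc n) ` ballot n k = {}"
    using notin by blast
  ultimately show ?thesis
    by (simp add: ballot_Suc[OF assms] card_Un_disjoint finite_ballot card_image)
qed

text \<open>
  The ballot number \<open>(n choose k + 1) - (n choose k)\<close> in additive form. The formula is also
  true for \<open>2(k + 1) = n + 1\<close>, where the two binomial coefficients agree and there is no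
  ballot set. Including this boundary case makes the induction hypothesis apply to both
  terms of the recurrence.
\<close>

lemma card_ballot:
  "2 * Suc k \<le> Suc n \<Longrightarrow> card (ballot n (Suc k)) + (n choose k) = n choose Suc k"
proof (induction n arbitrary: k)
  case 0
  then show ?case by simp
next
  case (Suc n)
  show ?case
  proof (cases "2 * Suc k = Suc (Suc n)")
    case True
    then have n: "Suc n = 2 * k + 1" by simp
    have "(Suc n choose k) = (Suc n choose Suc k)"
      unfolding n by (subst binomial_symmetric) auto
    moreover have "ballot (Suc n) (Suc k) = {}"
      by (rule ballot_empty) (use True in simp)
    ultimately show ?thesis by simp
  next
    case False
    then have le: "2 * Suc k \<le> Suc n" using Suc.prems by simp
    show ?thesis
    proof (cases k)
      case 0
      then show ?thesis using Suc.IH[OF le] card_ballot_Suc[OF le] by (simp add: ballot_0)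
    next
      case (Suc l)
      then show ?thesis
        using Suc.IH[OF le] Suc.IH[of l] card_ballot_Suc[OF le] le by simp
    qed
  qed
qed

lemma card_ballot_eq_catalan:
  assumes "d \<ge> 1"
  shows "real (card (ballot (2 * d) d)) = catalan d"
proof -
  obtain k where d: "d = Suc k" using assms by (cases d) auto
  have "card (ballot (2 * d) d) + (2 * d choose k) = (2 * d choose d)"
    using card_ballot[of k "2 * d"] d by simp
  then have eq: "real (card (ballot (2 * d) d)) = real (2 * d choose d) - real (2 * d choose k)"
    by linarith
  have "Suc k * (2 * d choose Suc k) = (2 * d - k) * (2 * d choose k)"
    using binomial_absorption[of k "2 * d"] binomial_absorb_comp[of "2 * d" k] by simp
  then have "d * (2 * d choose d) = (d + 1) * (2 * d choose k)"
    by (simp add: d)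
  then have "real d * real (2 * d choose d) = (real d + 1) * real (2 * d choose k)"
    by (metis of_nat_1 of_nat_add of_nat_mult)
  then show ?thesis
    unfolding eq catalan_def by (simp add: field_simps)
qed

section \<open>Minimal permutations of length twice the number of descents\<close>

lemma num_descents_split:
  "num_descents (us @ x # vs) = num_descents (us @ [x]) + num_descents (x # vs)"
proof (induction us)
  case Nil
  then show ?case by (simp add: num_descents_single)
next
  case (Cons a us)
  then show ?case by (cases us) (auto simp: num_descents_Cons num_descents_single)
qed

text \<open>
  The comparisons of the removed entry with its neighbours disappear and the comparison
  of the two neighbours appears. Balancing them in one equation that also covers the
  two ends lets both directions of the characterization use the same fact.
\<close>

lemma num_descents_remove_nth:
  assumes "i < length xs"
  shows "num_descents xs
      + of_bool (0 < i \<and> Suc i < length xs \<and> xs ! (i - 1) > xs ! Suc i)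
    = num_descents (take i xs @ drop (Suc i) xs)
      + of_bool (0 < i \<and> xs ! (i - 1) > xs ! i)
      + of_bool (Suc i < length xs \<and> xs ! i > xs ! Suc i)"
proof -
  define ys x zs where "ys = take i xs" and "x = xs ! i" and "zs = drop (Suc i) xs"
  have xs: "xs = ys @ x # zs" and i: "i = length ys"
    using assms by (simp_all add: ys_def x_def zs_def id_take_nth_drop)
  have rem: "take i xs @ drop (Suc i) xs = ys @ zs"
    by (simp add: ys_def zs_def)
  show ?thesis
  proof (cases ys rule: rev_cases)
    case Nil
    then show ?thesis unfolding rem unfolding xs i
      by (cases zs) (auto simp: num_descents_Cons num_descents_single num_descents_Nil)
  next
    case (snoc us a)
    show ?thesis
    proof (cases zs)
      case zs: Nil
      show ?thesis unfolding rem unfolding xs i snoc zs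
        using num_descents_split[of us a "[x]"]
        by (auto simp: num_descents_Cons num_descents_single nth_append)
    next
      case zs: (Cons b vs)
      show ?thesis unfolding rem unfolding xs i snoc zs
        using num_descents_split[of us a "x # b # vs"] num_descents_split[of us a "b # vs"]
        by (auto simp: num_descents_Cons nth_append)
    qed
  qed
qed

lemma num_descents_eq_sum:
  "num_descents xs = (\<Sum>i<length xs - 1. of_bool (xs ! i > xs ! Suc i))"
proof -
  have "descents xs = {i \<in> {..<length xs - 1}. xs ! i > xs ! Suc i}"
    by (auto simp: descents_def)
  then show ?thesis
    by (simp add: num_descents_def of_bool_def sum.If_cases Int_def)
qed

text \<open>
  Group the positions other than \<open>2k + 1\<close> into pairs of neighbours, leaving the first and
  the last position on their own: before \<open>2k + 1\<close> they contribute at least \<open>k + 1\<close> and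
  after it at least \<open>m - k\<close>, which already exhausts the total.
\<close>

lemma alternating_of_sum:
  fixes f :: "nat \<Rightarrow> nat"
  assumes first: "f 0 \<ge> 1" and last: "f (2 * m) \<ge> 1"
    and pair: "\<And>i. i < 2 * m \<Longrightarrow> f i + f (Suc i) \<ge> 1"
    and total: "(\<Sum>i<2 * m + 1. f i) = m + 1"
    and k: "k < m"
  shows "f (2 * k + 1) = 0"
proof -
  have prefix: "(\<Sum>i<2 * l + 1. f i) \<ge> l + 1" if "l \<le> m" for l
    using that
  proof (induction l)
    case 0
    then show ?case using first by simp
  next
    case (Suc l)
    then show ?case using pair[of "2 * l + 1"] by simp
  qed
  have suffix: "(\<Sum>i=2 * (m - l)..<2 * m + 1. f i) \<ge> l + 1" if "l \<le> m" for l
    using that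
  proof (induction l)
    case 0
    then show ?case using last by simp
  next
    case (Suc l)
    define s where "s = 2 * (m - Suc l)"
    have s: "2 * (m - l) = Suc (Suc s)" "s < 2 * m" "Suc s < 2 * m"
      using Suc.prems by (auto simp: s_def)
    then show ?case
      using Suc pair[OF s(2)] unfolding s_def[symmetric]
      by (simp add: sum.atLeast_Suc_lessThan)
  qed
  have "(\<Sum>i<2 * m + 1. f i) =
      (\<Sum>i<2 * k + 1. f i) + f (2 * k + 1) + (\<Sum>i=2 * (k + 1)..<2 * m + 1. f i)"
    using k by (subst sum.atLeastLessThan_concat[of 0 "2 * k + 2" "2 * m + 1" f, symmetric,
        unfolded atLeast0LessThan]) simp_all
  moreover have "(\<Sum>i<2 * k + 1. f i) \<ge> k + 1"
    by (rule prefix) (use k in simp)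
  moreover have "(\<Sum>i=2 * (k + 1)..<2 * m + 1. f i) \<ge> m - k"
    using suffix[of "m - k - 1"] k by (simp add: Suc_diff_Suc)
  ultimately show ?thesis using total k by linarith
qed

text \<open>
  The standard Young tableaux with two columns, read row by row with each row
  written in decreasing order; comparing entries two positions apart treats both
  columns at once.
\<close>

definition two_column :: "nat list \<Rightarrow> bool" where
  "two_column xs \<longleftrightarrow>
     (\<forall>i. 2 * i + 1 < length xs \<longrightarrow> xs ! (2 * i + 1) < xs ! (2 * i)) \<and>
     (\<forall>i. i + 2 < length xs \<longrightarrow> xs ! i < xs ! (i + 2))"

lemma two_column_descent_iff:
  assumes "two_column xs" "Suc i < length xs"
  shows "xs ! i > xs ! Suc i \<longleftrightarrow> even i"
proof (cases "even i")
  case True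
  then show ?thesis using assms by (auto simp: two_column_def elim!: evenE)
next
  case False
  then obtain k where k: "i = 2 * k + 1" by (rule oddE)
  have "xs ! (2 * k + 1) < xs ! (2 * k)" "xs ! (2 * k) < xs ! (2 * k + 2)"
    using assms k by (auto simp: two_column_def)
  then show ?thesis using False k by simp
qed

lemma sum_even_indices: "(\<Sum>i<2 * d. of_bool (even i)) = (d :: nat)"
  by (induction d) auto

text \<open>
  With \<open>D i\<close> indicating a descent at \<open>i\<close>, minimality says \<open>D i + D (i + 1) = 1\<close> plus 1 if
  \<open>\<sigma> ! i > \<sigma> ! (i + 2)\<close>. Once the descents are known to alternate, the last term must be 0.
\<close>

lemma minimal_perm_imp_two_column:
  assumes "d \<ge> 1" and min: "minimal_perm (2 * d) d \<sigma>"
  shows "two_column \<sigma>"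
proof -
  obtain m where m: "d = Suc m" using assms(1) by (cases d) auto
  have perm: "\<sigma> \<in> permutations_of_set {1..2 * d}" and des: "num_descents \<sigma> = d"
    and rem: "\<And>i. i < 2 * d \<Longrightarrow> num_descents (remove_entry i \<sigma>) = d - 1"
    using min minimal_perm_iff_remove[OF assms(1)] by auto
  have len: "length \<sigma> = 2 * d" and dist: "distinct \<sigma>"
    using perm by (auto simp: length_finite_permutations_of_set permutations_of_set_def)
  define D where "D i = (of_bool (\<sigma> ! i > \<sigma> ! Suc i) :: nat)" for i
  have loss: "1 + of_bool (0 < i \<and> Suc i < 2 * d \<and> \<sigma> ! (i - 1) > \<sigma> ! Suc i)
      = (of_bool (0 < i \<and> \<sigma> ! (i - 1) > \<sigma> ! i)
        + of_bool (Suc i < 2 * d \<and> \<sigma> ! i > \<sigma> ! Suc i) :: nat)"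
    if "i < 2 * d" for i
    using num_descents_remove_nth[of i \<sigma>] rem[OF that] that des assms(1)
    by (simp add: len remove_entry_def)
  have first: "D 0 \<ge> 1"
    using loss[of 0] assms(1) by (auto simp: D_def split: if_splits)
  have last: "D (2 * m) \<ge> 1"
    using loss[of "2 * m + 1"] by (auto simp: D_def m split: if_splits)
  have inner: "1 + of_bool (\<sigma> ! i > \<sigma> ! (i + 2)) = D i + D (Suc i)" if "i < 2 * m" for i
    using loss[of "Suc i"] that by (simp add: D_def m)
  have pair: "D i + D (Suc i) \<ge> 1" if "i < 2 * m" for i
    using inner[OF that] by linarith
  have total: "(\<Sum>i<2 * m + 1. D i) = m + 1"
    using des num_descents_eq_sum[of \<sigma>] by (simp add: len m D_def)
  have odd: "D (2 * k + 1) = 0" if "k < m" for k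
    by (rule alternating_of_sum[OF first last pair total that])
  have even: "D (2 * k) = 1" if "k \<le> m" for k
  proof (cases "k = m")
    case True
    then show ?thesis using last by (simp add: D_def of_bool_def split: if_splits)
  next
    case False
    then show ?thesis
      using that odd[of k] pair[of "2 * k"] by (simp add: D_def of_bool_def split: if_splits)
  qed
  have "\<sigma> ! i < \<sigma> ! (i + 2)" if "i < 2 * m" for i
  proof -
    have "D i + D (Suc i) = 1"
    proof (cases "even i")
      case True
      then obtain k where k: "i = 2 * k" by (rule evenE)
      then show ?thesis using that even[of k] odd[of k] by simp
    next
      case False
      then obtain k where k: "i = 2 * k + 1" by (rule oddE)
      then show ?thesis using that even[of "k + 1"] odd[of k] by simp
    qed
    then have "\<not> \<sigma> ! i > \<sigma> ! (i + 2)" using inner[OF that] by (auto split: if_splits)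
    moreover have "\<sigma> ! i \<noteq> \<sigma> ! (i + 2)"
      using that dist len m by (simp add: nth_eq_iff_index_eq)
    ultimately show ?thesis by simp
  qed
  moreover have "\<sigma> ! (2 * i + 1) < \<sigma> ! (2 * i)" if "i \<le> m" for i
    using even[OF that] by (simp add: D_def of_bool_def split: if_splits)
  ultimately show ?thesis
    by (auto simp: two_column_def len m)
qed

lemma two_column_imp_minimal_perm:
  assumes "d \<ge> 1" and perm: "\<sigma> \<in> permutations_of_set {1..2 * d}" and tc: "two_column \<sigma>"
  shows "minimal_perm (2 * d) d \<sigma>"
proof -
  have len: "length \<sigma> = 2 * d"
    using perm by (auto simp: length_finite_permutations_of_set)
  obtain m where m: "d = Suc m" using assms(1) by (cases d) auto
  have "num_descents \<sigma> = (\<Sum>i<2 * d - 1. of_bool (even i))"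
    unfolding num_descents_eq_sum len
    by (intro sum.cong refl) (use two_column_descent_iff[OF tc] len in auto)
  also have "\<dots> = d"
    using sum_even_indices[of d] by (simp add: m)
  finally have des: "num_descents \<sigma> = d" .
  have "num_descents (remove_entry i \<sigma>) = d - 1" if i: "i < 2 * d" for i
  proof -
    have "(of_bool (0 < i \<and> \<sigma> ! (i - 1) > \<sigma> ! i)
        + of_bool (Suc i < 2 * d \<and> \<sigma> ! i > \<sigma> ! Suc i) :: nat) = 1"
    proof (cases i)
      case 0
      then show ?thesis using two_column_descent_iff[OF tc, of 0] len assms(1) by simp
    next
      case (Suc j)
      have j: "\<sigma> ! j > \<sigma> ! Suc j \<longleftrightarrow> even j"
        using two_column_descent_iff[OF tc, of j] len Suc i by simp
      show ?thesis
      proof (cases "Suc i < 2 * d")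
        case True
        then show ?thesis using two_column_descent_iff[OF tc, of i] len Suc j by auto
      next
        case False
        then have "j = 2 * m" using i Suc m by simp
        then show ?thesis using False Suc j by simp
      qed
    qed
    moreover have "\<not> (0 < i \<and> Suc i < 2 * d \<and> \<sigma> ! (i - 1) > \<sigma> ! Suc i)"
    proof
      assume *: "0 < i \<and> Suc i < 2 * d \<and> \<sigma> ! (i - 1) > \<sigma> ! Suc i"
      then obtain j where "i = Suc j" by (cases i) auto
      moreover from this have "\<sigma> ! j < \<sigma> ! (j + 2)"
        using * tc len by (simp add: two_column_def)
      ultimately show False using * by simp
    qed
    then have "(of_bool (0 < i \<and> Suc i < 2 * d \<and> \<sigma> ! (i - 1) > \<sigma> ! Suc i) :: nat) = 0"
      by (simp only: of_bool_eq_0_iff not_False_eq_True)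
    ultimately have "d = num_descents (take i \<sigma> @ drop (Suc i) \<sigma>) + 1"
      using num_descents_remove_nth[of i \<sigma>] i unfolding len des by linarith
    then show ?thesis by (simp add: remove_entry_def)
  qed
  then show ?thesis
    using minimal_perm_iff_remove[OF assms(1)] perm des by blast
qed

section \<open>From permutations to ballot sets\<close>

text \<open>
  Lets entrywise comparison of increasing lists be exchanged for comparison of the
  counting functions of their sets, the form in which the ballot condition is stated.
\<close>

lemma nth_le_iff_less_card:
  fixes xs :: "nat list"
  assumes "sorted_wrt (<) xs" "i < length xs"
  shows "xs ! i \<le> y \<longleftrightarrow> i < card {x \<in> set xs. x \<le> y}"
proof -
  have inj: "inj_on ((!) xs) {k. k < length xs \<and> xs ! k \<le> y}"
    using assms(1) by (auto simp: inj_on_def strict_sorted_iff nth_eq_iff_index_eq)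
  have "{x \<in> set xs. x \<le> y} = (!) xs ` {k. k < length xs \<and> xs ! k \<le> y}"
    by (auto simp: set_conv_nth)
  then have card: "card {x \<in> set xs. x \<le> y} = card {k. k < length xs \<and> xs ! k \<le> y}"
    using card_image[OF inj] by simp
  have mono: "xs ! k \<le> xs ! l" if "k \<le> l" "l < length xs" for k l
    using assms(1) that by (cases "k = l") (auto simp: sorted_wrt_iff_nth_less less_imp_le)
  show ?thesis
  proof
    assume "xs ! i \<le> y"
    then have "{..i} \<subseteq> {k. k < length xs \<and> xs ! k \<le> y}"
      using assms(2) mono by (auto intro: order_trans)
    from card_mono[OF _ this] show "i < card {x \<in> set xs. x \<le> y}"
      by (simp add: card)
  next
    assume less: "i < card {x \<in> set xs. x \<le> y}"
    show "xs ! i \<le> y"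
    proof (rule ccontr)
      assume "\<not> xs ! i \<le> y"
      then have "{k. k < length xs \<and> xs ! k \<le> y} \<subseteq> {..<i}"
        using mono by (auto simp: not_le[symmetric]) (meson not_le order_trans)
      from card_mono[OF _ this] less show False by (simp add: card)
    qed
  qed
qed

text \<open>
  As the two lists partition \<open>{1..2 * d}\<close>, the ballot condition at \<open>j\<close> says that \<open>as\<close> has at
  most as many elements \<open>\<le> j\<close> as \<open>bs\<close>. If this holds at \<open>j = as ! i\<close>, then \<open>bs ! i \<le> as ! i\<close>;
  conversely, if \<open>as ! t\<close> is the last entry of \<open>as\<close> up to \<open>j\<close>, then \<open>bs ! t \<le> j\<close> as well.
\<close>

lemma ballot_iff_dominated:
  fixes as bs :: "nat list"
  assumes as: "sorted_wrt (<) as" "length as = d"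
    and bs: "sorted_wrt (<) bs" "length bs = d"
    and part: "set as \<union> set bs = {1..2 * d}" "set as \<inter> set bs = {}"
  shows "set as \<in> ballot (2 * d) d \<longleftrightarrow> (\<forall>i<d. bs ! i < as ! i)"
proof -
  have count: "card {x \<in> set as. x \<le> j} + card {x \<in> set bs. x \<le> j} = j" if "j \<le> 2 * d" for j
  proof -
    have "card {x \<in> set as. x \<le> j} + card {x \<in> set bs. x \<le> j}
        = card ({x \<in> set as. x \<le> j} \<union> {x \<in> set bs. x \<le> j})"
      using part(2) by (intro card_Un_disjoint[symmetric]) auto
    also have "{x \<in> set as. x \<le> j} \<union> {x \<in> set bs. x \<le> j} = {x \<in> {1..2 * d}. x \<le> j}"
      unfolding part(1)[symmetric] by auto
    also have "\<dots> = {1..j}" using that by auto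
    finally show ?thesis by simp
  qed
  have card_as: "card (set as) = d"
    using as by (simp add: strict_sorted_iff distinct_card)
  have "set as \<inter> {1..j} = {x \<in> set as. x \<le> j}" for j
    using part(1) by (auto simp: set_eq_iff)
  then have ballot: "set as \<in> ballot (2 * d) d \<longleftrightarrow>
      (\<forall>j\<le>2 * d. card {x \<in> set as. x \<le> j} \<le> card {x \<in> set bs. x \<le> j})"
    using part(1) card_as count by (fastforce simp: ballot_def)
  show ?thesis unfolding ballot
  proof (intro iffI allI impI)
    fix i assume *: "\<forall>j\<le>2 * d. card {x \<in> set as. x \<le> j} \<le> card {x \<in> set bs. x \<le> j}"
      and i: "i < d"
    have mem: "as ! i \<in> set as" "bs ! i \<in> set bs" using i as bs by auto
    then have "as ! i \<le> 2 * d" using part(1) by auto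
    moreover have "i < card {x \<in> set as. x \<le> as ! i}"
      using nth_le_iff_less_card[of as i "as ! i"] as i by simp
    ultimately have "i < card {x \<in> set bs. x \<le> as ! i}"
      using * by (meson less_le_trans)
    then have "bs ! i \<le> as ! i"
      using nth_le_iff_less_card[of bs i "as ! i"] bs i by simp
    moreover have "bs ! i \<noteq> as ! i" using mem part(2) by auto
    ultimately show "bs ! i < as ! i" by simp
  next
    fix j assume *: "\<forall>i<d. bs ! i < as ! i" and "j \<le> 2 * d"
    show "card {x \<in> set as. x \<le> j} \<le> card {x \<in> set bs. x \<le> j}"
    proof (cases "card {x \<in> set as. x \<le> j}")
      case (Suc t)
      have "card {x \<in> set as. x \<le> j} \<le> card (set as)" by (intro card_mono) auto
      then have t: "t < d" using Suc card_as by simp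
      then have "as ! t \<le> j"
        using nth_le_iff_less_card[of as t j] as Suc by simp
      then have "bs ! t \<le> j" using * t by (meson less_le_trans less_imp_le)
      then show ?thesis
        using nth_le_iff_less_card[of bs t j] bs t Suc by simp
    qed (simp only: le0)
  qed
qed

definition evens :: "nat list \<Rightarrow> nat list" where
  "evens xs = map (\<lambda>i. xs ! (2 * i)) [0..<length xs div 2]"

definition odds :: "nat list \<Rightarrow> nat list" where
  "odds xs = map (\<lambda>i. xs ! (2 * i + 1)) [0..<length xs div 2]"

definition interleave :: "nat list \<Rightarrow> nat list \<Rightarrow> nat list" where
  "interleave as bs =
     map (\<lambda>i. if even i then as ! (i div 2) else bs ! (i div 2)) [0..<2 * length as]"

lemma length_evens [simp]: "length (evens xs) = length xs div 2"
  and length_odds [simp]: "length (odds xs) = length xs div 2"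
  by (simp_all add: evens_def odds_def)

lemma evens_interleave: "length bs = length as \<Longrightarrow> evens (interleave as bs) = as"
  and odds_interleave: "length bs = length as \<Longrightarrow> odds (interleave as bs) = bs"
  by (auto simp: evens_def odds_def interleave_def intro!: nth_equalityI)

lemma interleave_evens_odds: "even (length xs) \<Longrightarrow> interleave (evens xs) (odds xs) = xs"
  by (auto simp: evens_def odds_def interleave_def intro!: nth_equalityI elim!: evenE oddE)

lemma set_evens_odds: "even (length xs) \<Longrightarrow> set (evens xs) \<union> set (odds xs) = set xs"
proof -
  assume ev: "even (length xs)"
  show ?thesis
  proof (intro Set.set_eqI iffI)
    fix x assume "x \<in> set (evens xs) \<union> set (odds xs)"
    then show "x \<in> set xs" using ev by (auto simp: evens_def odds_def elim!: evenE)
  next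
    fix x assume "x \<in> set xs"
    then obtain i where "i < length xs" "x = xs ! i" by (auto simp: in_set_conv_nth)
    then show "x \<in> set (evens xs) \<union> set (odds xs)"
      using ev by (cases "even i") (auto simp: evens_def odds_def elim!: evenE oddE)
  qed
qed

lemma two_column_iff:
  assumes "length xs = 2 * d"
  shows "two_column xs \<longleftrightarrow> sorted_wrt (<) (evens xs) \<and> sorted_wrt (<) (odds xs) \<and>
    (\<forall>i<d. odds xs ! i < evens xs ! i)"
proof -
  have ev: "sorted_wrt (<) (evens xs) \<longleftrightarrow> (\<forall>k. Suc k < d \<longrightarrow> xs ! (2 * k) < xs ! (2 * k + 2))"
    using assms by (simp add: sorted_wrt_iff_nth_Suc_transp evens_def)
  have od: "sorted_wrt (<) (odds xs) \<longleftrightarrow> (\<forall>k. Suc k < d \<longrightarrow> xs ! (2 * k + 1) < xs ! (2 * k + 3))"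
    using assms by (simp add: sorted_wrt_iff_nth_Suc_transp odds_def numeral_3_eq_3)
  have "(\<forall>i. i + 2 < length xs \<longrightarrow> xs ! i < xs ! (i + 2)) \<longleftrightarrow>
      sorted_wrt (<) (evens xs) \<and> sorted_wrt (<) (odds xs)"
    unfolding ev od
  proof (intro iffI conjI allI impI)
    fix k assume *: "\<forall>i. i + 2 < length xs \<longrightarrow> xs ! i < xs ! (i + 2)" and k: "Suc k < d"
    show "xs ! (2 * k) < xs ! (2 * k + 2)" using * k assms by simp
    show "xs ! (2 * k + 1) < xs ! (2 * k + 3)"
      using *[rule_format, of "2 * k + 1"] k assms by (simp add: numeral_3_eq_3)
  next
    fix i assume *: "(\<forall>k. Suc k < d \<longrightarrow> xs ! (2 * k) < xs ! (2 * k + 2)) \<and>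
        (\<forall>k. Suc k < d \<longrightarrow> xs ! (2 * k + 1) < xs ! (2 * k + 3))"
      and i: "i + 2 < length xs"
    show "xs ! i < xs ! (i + 2)"
    proof (cases "even i")
      case True
      then show ?thesis using * i assms by (auto elim!: evenE)
    next
      case False
      then show ?thesis using * i assms by (auto elim!: oddE simp: numeral_3_eq_3)
    qed
  qed
  moreover have "(\<forall>i. 2 * i + 1 < length xs \<longrightarrow> xs ! (2 * i + 1) < xs ! (2 * i)) \<longleftrightarrow>
      (\<forall>i<d. odds xs ! i < evens xs ! i)"
    using assms by (auto simp: odds_def evens_def)
  ultimately show ?thesis unfolding two_column_def by blast
qed

text \<open>
  The inverse sorts the set and its complement, since both columns of a tableau are
  increasing, and interleaves the two lists.
\<close>

lemma bij_betw_two_column_ballot: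
  "bij_betw (\<lambda>\<sigma>. set (evens \<sigma>))
     {\<sigma> \<in> permutations_of_set {1..2 * d}. two_column \<sigma>} (ballot (2 * d) d)"
proof (rule bij_betw_byWitness)
  let ?X = "{\<sigma> \<in> permutations_of_set {1..2 * d}. two_column \<sigma>}"
  let ?g = "\<lambda>A. interleave (sorted_list_of_set A) (sorted_list_of_set ({1..2 * d} - A))"
  have X: "length \<sigma> = 2 * d \<and> sorted_wrt (<) (evens \<sigma>) \<and> sorted_wrt (<) (odds \<sigma>) \<and>
      (\<forall>i<d. odds \<sigma> ! i < evens \<sigma> ! i) \<and>
      set (evens \<sigma>) \<union> set (odds \<sigma>) = {1..2 * d} \<and> set (evens \<sigma>) \<inter> set (odds \<sigma>) = {}"
    if "\<sigma> \<in> ?X" for \<sigma>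
  proof -
    have len: "length \<sigma> = 2 * d" and dist: "distinct \<sigma>" and set: "set \<sigma> = {1..2 * d}"
      using that by (auto simp: length_finite_permutations_of_set permutations_of_set_def)
    have "\<sigma> ! (2 * i) \<noteq> \<sigma> ! (2 * k + 1)" if "i < d" "k < d" for i k
    proof -
      have "2 * i \<noteq> 2 * k + 1" by presburger
      then show ?thesis using that dist len by (simp add: nth_eq_iff_index_eq)
    qed
    then have "set (evens \<sigma>) \<inter> set (odds \<sigma>) = {}"
      using len by (auto simp: evens_def odds_def)
    then show ?thesis
      using that len set set_evens_odds[of \<sigma>] two_column_iff[OF len] by auto
  qed
  show "\<forall>\<sigma>\<in>?X. ?g (set (evens \<sigma>)) = \<sigma>"
  proof
    fix \<sigma> assume "\<sigma> \<in> ?X"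
    note s = X[OF this]
    have "{1..2 * d} - set (evens \<sigma>) = set (odds \<sigma>)" using s by auto
    then show "?g (set (evens \<sigma>)) = \<sigma>"
      using s by (simp add: sorted_list_of_set.idem_if_sorted_distinct strict_sorted_iff interleave_evens_odds)
  qed
  show "(\<lambda>\<sigma>. set (evens \<sigma>)) ` ?X \<subseteq> ballot (2 * d) d"
  proof (rule image_subsetI)
    fix \<sigma> assume "\<sigma> \<in> ?X"
    from X[OF this] show "set (evens \<sigma>) \<in> ballot (2 * d) d"
      using ballot_iff_dominated[of "evens \<sigma>" d "odds \<sigma>"] by simp
  qed
  have Y: "set (evens (?g A)) = A \<and> ?g A \<in> ?X" if A: "A \<in> ballot (2 * d) d" for A
  proof -
    define as bs where "as = sorted_list_of_set A"
      and "bs = sorted_list_of_set ({1..2 * d} - A)"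
    have sub: "A \<subseteq> {1..2 * d}" and card: "card A = d" using A by (auto simp: ballot_def)
    have fin: "finite A" using sub finite_subset by blast
    have as: "sorted_wrt (<) as" "length as = d" "set as = A"
      using fin card by (simp_all add: as_def)
    have bs: "sorted_wrt (<) bs" "length bs = d" "set bs = {1..2 * d} - A"
      using fin card sub by (simp_all add: bs_def card_Diff_subset)
    have dom: "\<forall>i<d. bs ! i < as ! i"
      using ballot_iff_dominated[OF as(1,2) bs(1,2)] as bs sub A by auto
    let ?\<sigma> = "interleave as bs"
    have len: "length ?\<sigma> = 2 * d" by (simp add: interleave_def as)
    have eo: "evens ?\<sigma> = as" "odds ?\<sigma> = bs"
      using as bs by (simp_all add: evens_interleave odds_interleave)
    have set: "set ?\<sigma> = {1..2 * d}"
      using set_evens_odds[of ?\<sigma>] len eo as bs sub by auto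
    then have "distinct ?\<sigma>" by (intro card_distinct) (simp add: len)
    with set have "?\<sigma> \<in> permutations_of_set {1..2 * d}"
      by (simp add: permutations_of_set_def)
    moreover have "two_column ?\<sigma>"
      using two_column_iff[OF len] eo as bs dom by simp
    ultimately show ?thesis using eo as unfolding as_def bs_def by simp
  qed
  show "\<forall>A\<in>ballot (2 * d) d. set (evens (?g A)) = A" using Y by blast
  show "?g ` ballot (2 * d) d \<subseteq> ?X" using Y by blast
qed

lemma num_minimal_perms_eq_card_ballot:
  assumes "d \<ge> 1"
  shows "num_minimal_perms (2 * d) d = card (ballot (2 * d) d)"
proof -
  have "{\<sigma>. minimal_perm (2 * d) d \<sigma>} = {\<sigma> \<in> permutations_of_set {1..2 * d}. two_column \<sigma>}"
    using minimal_perm_imp_two_column[OF assms] two_column_imp_minimal_perm[OF assms]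
    by (auto simp: minimal_perm_def)
  then show ?thesis
    using bij_betw_same_card[OF bij_betw_two_column_ballot[of d]]
    by (simp add: num_minimal_perms_def)
qed

theorem mainTheorem3:
  fixes d :: nat
  assumes "d \<ge> 1"
  shows "catalan d = real (num_minimal_perms (2 * d) d)
       \<and> real (num_minimal_perms (2 * d) d) = fact (2 * d) * det (M_mat d)"
proof -
  have count: "catalan d = real (num_minimal_perms (2 * d) d)"
    using card_ballot_eq_catalan[OF assms] num_minimal_perms_eq_card_ballot[OF assms] by simp
  have "real (2 * d choose d) = fact (2 * d) / (fact d * fact d)"
    by (subst binomial_fact) simp_all
  then have "catalan d = fact (2 * d) * det (M_mat d)"
    by (simp add: catalan_def det_M_mat mult_ac add_ac)
  with count show ?thesis by simp
qed

end
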